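(* Let $\chi$ and $\omega$ be two Hermitian metrics on a compact complex manifold, with $\chi=i\chi_{\bar kj}\,dz^j\wedge d\bar z^k$ and $\omega=i g_{\bar kj}\,dz^j\wedge d\bar z^k$ in local holomorphic coordinates, and let $h^p{}_q=\chi^{p\bar r}g_{\bar rq}$. Then, at every point, $$\begin{aligned} &\frac{g^{j\bar k}\,\partial_j\operatorname{Tr}h\,\partial_{\bar k}\operatorname{Tr}h}{\operatorname{Tr}h}-\chi^{p\bar q}\operatorname{Tr}\!\left(h^{-1}\nabla_p h\,h^{-1}\nabla_{\bar q}h\right)-\operatorname{Re}\,\chi^{p\bar q}\chi_{\bar sr}g^{j\bar k}\,\nabla_p h^r{}_j\,\overline{T^s_{qk}}-\operatorname{Re}\,g^{j\bar k}\,\nabla_{\bar k}h^p{}_r\,T^r_{pj}\\ &\le -2\operatorname{Re}\,g^{j\bar k}\frac{\partial_j\operatorname{Tr}h}{\operatorname{Tr}h}\overline{T_k}-\frac{1}{\operatorname{Tr}h}g^{j\bar k}T_j\overline{T_k}+\chi^{p\bar q}g^{j\bar k}\chi_{\bar sr}T^r_{pj}\overline{T^s_{qk}}\\ &\quad+2\operatorname{Re}\,g^{j\bar k}\frac{\partial_j\operatorname{Tr}h}{\operatorname{Tr}h}\overline{\alpha_k}+\frac{1}{\operatorname{Tr}h}2\operatorname{Re}\,g^{j\bar k}T_j\overline{\alpha_k}-\operatorname{Re}\,\chi^{p\bar q}g^{j\bar k}T^r_{pj}\overline{\alpha_{\bar rqk}}-\frac{1}{\operatorname{Tr}h}g^{j\bar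 k}\alpha_j\overline{\alpha_k}, \end{aligned}$$ where $T$ is the torsion of the Chern connection $\nabla$ of $\chi$, $T_j=T^p_{pj}$, and $\alpha_{\bar qpj}=\partial_j(g_{\bar qp}-\chi_{\bar qp})-\partial_p(g_{\bar qj}-\chi_{\bar qj})$, $\alpha_j=\chi^{p\bar q}\alpha_{\bar qpj}$.
   Context: Repeated indices are summed. $\chi^{j\bar k}$ and $g^{j\bar k}$ denote the inverse matrices: $\chi^{j\bar k}\chi_{\bar k\ell}=\delta^j{}_\ell$, $g^{j\bar k}g_{\bar k\ell}=\delta^j{}_\ell$. $h$ is an endomorphism of $T^{1,0}X$ with inverse $h^{-1}$, and $\operatorname{Tr}$ is the trace of endomorphisms. $\nabla$ is the Chern connection of $\chi$: on sections $V$ of $T^{1,0}X$, $\nabla_jV^p=\partial_jV^p+\Gamma^p_{jq}V^q$ and $\nabla_{\bar k}V^p=\partial_{\bar k}V^p$, where $\Gamma^p_{jq}=\chi^{p\bar r}\partial_j\chi_{\bar rq}$, extended in the usual way to all tensors (in particular to endomorphisms of $T^{1,0}X$). Its torsion is $T^p_{jq}=\Gamma^p_{jq}-\Gamma^p_{qj}$ and its torsion 1-form is $T_j=T^p_{pj}$. Each "$\operatorname{Re}$" applies to the whole contracted product that follows it. *)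

theory Defs
  imports "HOL-Analysis.Analysis"
begin

section \<open>Holomorphic and smooth functions on open subsets of complex n-space\<close>

definition holomorphic_map_on ::
  "(complex^'n \<Rightarrow> complex^'m) \<Rightarrow> (complex^'n) set \<Rightarrow> bool"
  where "holomorphic_map_on f S \<longleftrightarrow>
    (\<forall>z\<in>S. \<exists>D. (f has_derivative D) (at z) \<and> (\<forall>c v. D (c *s v) = c *s D v))"

primrec Ck_on :: "nat \<Rightarrow> (complex^'n \<Rightarrow> complex) \<Rightarrow> (complex^'n) set \<Rightarrow> bool"
  where
    "Ck_on 0 f S \<longleftrightarrow> continuous_on S f"
  | "Ck_on (Suc k) f S \<longleftrightarrow>
      (\<forall>z\<in>S. f differentiable (at z)) \<and>
      (\<forall>v. Ck_on k (\<lambda>z. frechet_derivative f (at z) v) S)"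

definition smooth_fun_on :: "(complex^'n \<Rightarrow> complex) \<Rightarrow> (complex^'n) set \<Rightarrow> bool"
  where "smooth_fun_on f S \<longleftrightarrow> (\<forall>k. Ck_on k f S)"

text \<open>
  With \<open>z\<^sub>j = x\<^sub>j + \<i> y\<^sub>j\<close>, the vectors \<open>axis j 1\<close> and \<open>axis j \<i>\<close> are the
  \<open>x\<^sub>j\<close>- and \<open>y\<^sub>j\<close>-directions.
\<close>

definition wirtinger :: "'n::finite \<Rightarrow> (complex^'n \<Rightarrow> complex) \<Rightarrow> complex^'n \<Rightarrow> complex"
  where "wirtinger j f z =
    (frechet_derivative f (at z) (axis j 1) - \<i> * frechet_derivative f (at z) (axis j \<i>)) / 2"

definition wirtinger_bar :: "'n::finite \<Rightarrow> (complex^'n \<Rightarrow> complex) \<Rightarrow> complex^'n \<Rightarrow> complex"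
  where "wirtinger_bar j f z =
    (frechet_derivative f (at z) (axis j 1) + \<i> * frechet_derivative f (at z) (axis j \<i>)) / 2"


section \<open>Complex manifolds\<close>

text \<open>
  A chart is a pair of its domain and its coordinate map; the values of the coordinate map
  outside the domain are irrelevant.
\<close>

type_synonym ('a, 'n) chart = "'a set \<times> ('a \<Rightarrow> complex^'n)"

fun chart_on :: "'a topology \<Rightarrow> ('a, 'n::finite) chart \<Rightarrow> bool"
  where "chart_on X (U, \<phi>) \<longleftrightarrow>
    openin X U \<and> open (\<phi> ` U) \<and> homeomorphic_map (subtopology X U) (top_of_set (\<phi> ` U)) \<phi>"

fun transition :: "('a, 'n::finite) chart \<Rightarrow> ('a, 'n) chart \<Rightarrow> complex^'n \<Rightarrow> complex^'n"
  where "transition (U, \<phi>) (V, \<psi>) = \<psi> \<circ> inv_into U \<phi>"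

fun overlap :: "('a, 'n::finite) chart \<Rightarrow> ('a, 'n) chart \<Rightarrow> (complex^'n) set"
  where "overlap (U, \<phi>) (V, \<psi>) = \<phi> ` (U \<inter> V)"

definition holo_compatible :: "('a, 'n::finite) chart \<Rightarrow> ('a, 'n) chart \<Rightarrow> bool"
  where "holo_compatible c d \<longleftrightarrow>
    holomorphic_map_on (transition c d) (overlap c d) \<and>
    holomorphic_map_on (transition d c) (overlap d c)"

text \<open>
  The atlas is maximal, so that its members are exactly the local holomorphic coordinate systems.
\<close>

definition complex_manifold :: "'a topology \<Rightarrow> ('a, 'n::finite) chart set \<Rightarrow> bool"
  where "complex_manifold X A \<longleftrightarrow>
    Hausdorff_space X \<and> second_countable X \<and>
    (\<forall>c\<in>A. chart_on X c) \<and> topspace X = (\<Union>c\<in>A. fst c) \<and>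
    (\<forall>c\<in>A. \<forall>d\<in>A. holo_compatible c d) \<and>
    (\<forall>c. chart_on X c \<and> (\<forall>d\<in>A. holo_compatible c d) \<longrightarrow> c \<in> A)"

definition compact_complex_manifold :: "'a topology \<Rightarrow> ('a, 'n::finite) chart set \<Rightarrow> bool"
  where "compact_complex_manifold X A \<longleftrightarrow> complex_manifold X A \<and> compact_space X"


section \<open>Hermitian metrics\<close>

definition hermitian_posdef :: "complex^'n^'n \<Rightarrow> bool"
  where "hermitian_posdef M \<longleftrightarrow>
    (\<forall>k j. M $ k $ j = cnj (M $ j $ k)) \<and>
    (\<forall>v. v \<noteq> 0 \<longrightarrow> 0 < Re (\<Sum>k\<in>UNIV. \<Sum>j\<in>UNIV. M $ k $ j * v $ j * cnj (v $ k)))"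

text \<open>
  A metric is given by its coefficient matrices in the charts: if \<open>M = chi c z\<close>, then
  \<open>M $ k $ j\<close> is the coefficient of \<open>\<i> dz\<^sub>j \<and> d\<zeta>\<^sub>k\<close> at the point with coordinates \<open>z\<close>, where
  \<open>\<zeta>\<^sub>k\<close> is the conjugate of \<open>z\<^sub>k\<close>.  So the first (row) index is the barred one, and the entry
  \<open>$ j $ k\<close> of the inverse matrix has its second index barred.  The last condition states
  that the coefficients transform as a tensor, i.e. define a global (1,1)-form.
\<close>

definition hermitian_metric ::
  "('a, 'n::finite) chart set \<Rightarrow> (('a, 'n) chart \<Rightarrow> complex^'n \<Rightarrow> complex^'n^'n) \<Rightarrow> bool"
  where "hermitian_metric A chi \<longleftrightarrow>
    (\<forall>(U, \<phi>)\<in>A. (\<forall>k j. smooth_fun_on (\<lambda>z. chi (U, \<phi>) z $ k $ j) (\<phi> ` U)) \<and>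
                (\<forall>z\<in>\<phi> ` U. hermitian_posdef (chi (U, \<phi>) z))) \<and>
    (\<forall>c\<in>A. \<forall>d\<in>A. \<forall>z\<in>overlap c d. \<forall>k j.
       chi c z $ k $ j =
         (\<Sum>l\<in>UNIV. \<Sum>m\<in>UNIV.
            chi d (transition c d z) $ l $ m
            * wirtinger j (\<lambda>w. transition c d w $ m) z
            * cnj (wirtinger k (\<lambda>w. transition c d w $ l) z)))"


section \<open>The Chern connection\<close>

text \<open>
  Here \<open>chi\<close> is the coefficient matrix of a metric as a function of the coordinates.
  Upper indices come first: \<open>christoffel chi p j q\<close> and \<open>torsion chi p j q\<close> have \<open>p\<close> raised.
\<close>

definition christoffel ::
  "(complex^'n \<Rightarrow> complex^'n^'n) \<Rightarrow> 'n::finite \<Rightarrow> 'n \<Rightarrow> 'n \<Rightarrow> complex^'n \<Rightarrow> complex"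
  where "christoffel chi p j q z =
    (\<Sum>r\<in>UNIV. matrix_inv (chi z) $ p $ r * wirtinger j (\<lambda>w. chi w $ r $ q) z)"

definition torsion ::
  "(complex^'n \<Rightarrow> complex^'n^'n) \<Rightarrow> 'n::finite \<Rightarrow> 'n \<Rightarrow> 'n \<Rightarrow> complex^'n \<Rightarrow> complex"
  where "torsion chi p j q z = christoffel chi p j q z - christoffel chi p q j z"

definition torsion_form ::
  "(complex^'n \<Rightarrow> complex^'n^'n) \<Rightarrow> 'n::finite \<Rightarrow> complex^'n \<Rightarrow> complex"
  where "torsion_form chi j z = (\<Sum>p\<in>UNIV. torsion chi p p j z)"

definition nabla_vec ::
  "(complex^'n \<Rightarrow> complex^'n^'n) \<Rightarrow> 'n::finite \<Rightarrow> (complex^'n \<Rightarrow> complex^'n) \<Rightarrow> complex^'n \<Rightarrow> complex^'n"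
  where "nabla_vec chi j V z =
    (\<chi> p. wirtinger j (\<lambda>w. V w $ p) z + (\<Sum>q\<in>UNIV. christoffel chi p j q z * V z $ q))"

definition nabla_bar_vec ::
  "'n::finite \<Rightarrow> (complex^'n \<Rightarrow> complex^'n) \<Rightarrow> complex^'n \<Rightarrow> complex^'n"
  where "nabla_bar_vec k V z = (\<chi> p. wirtinger_bar k (\<lambda>w. V w $ p) z)"

text \<open>
  The induced connection on endomorphisms; the Leibniz rules below characterise it.
\<close>

definition nabla_end ::
  "(complex^'n \<Rightarrow> complex^'n^'n) \<Rightarrow> 'n::finite \<Rightarrow> (complex^'n \<Rightarrow> complex^'n^'n) \<Rightarrow> complex^'n \<Rightarrow> complex^'n^'n"
  where "nabla_end chi j H z =
    (\<chi> p q. wirtinger j (\<lambda>w. H w $ p $ q) z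
      + (\<Sum>s\<in>UNIV. christoffel chi p j s z * H z $ s $ q)
      - (\<Sum>s\<in>UNIV. christoffel chi s j q z * H z $ p $ s))"

definition nabla_bar_end ::
  "'n::finite \<Rightarrow> (complex^'n \<Rightarrow> complex^'n^'n) \<Rightarrow> complex^'n \<Rightarrow> complex^'n^'n"
  where "nabla_bar_end k H z = (\<chi> p q. wirtinger_bar k (\<lambda>w. H w $ p $ q) z)"

lemma frechet_derivative_sum_mult:
  fixes F G :: "'i::finite \<Rightarrow> complex^'n \<Rightarrow> complex"
  assumes "\<And>q. F q differentiable (at z)" "\<And>q. G q differentiable (at z)"
  shows "frechet_derivative (\<lambda>w. \<Sum>q\<in>UNIV. F q w * G q w) (at z) =
    (\<lambda>v. \<Sum>q\<in>UNIV. F q z * frechet_derivative (G q) (at z) v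
                  + frechet_derivative (F q) (at z) v * G q z)"
  by (rule frechet_derivative_at[symmetric], intro has_derivative_sum has_derivative_mult)
     (use assms in \<open>simp_all add: frechet_derivative_works\<close>)

lemma nabla_end_Leibniz:
  assumes "\<And>p q. (\<lambda>w. H w $ p $ q) differentiable (at z)"
    and "\<And>q. (\<lambda>w. V w $ q) differentiable (at z)"
  shows "nabla_vec chi j (\<lambda>w. H w *v V w) z
    = nabla_end chi j H z *v V z + H z *v nabla_vec chi j V z"
proof -
  have W: "wirtinger j (\<lambda>w. \<Sum>q\<in>UNIV. H w $ p $ q * V w $ q) z =
      (\<Sum>q\<in>UNIV. H z $ p $ q * wirtinger j (\<lambda>w. V w $ q) z)
    + (\<Sum>q\<in>UNIV. wirtinger j (\<lambda>w. H w $ p $ q) z * V z $ q)" for p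
    using assms unfolding wirtinger_def
    by (subst (1 2) frechet_derivative_sum_mult)
      (simp_all add: sum.distrib sum_distrib_left sum_subtractf
        sum_divide_distrib algebra_simps diff_divide_distrib add_divide_distrib)
  have S1: "(\<Sum>q\<in>UNIV. christoffel chi p j q z * (\<Sum>s\<in>UNIV. H z $ q $ s * V z $ s)) =
      (\<Sum>q\<in>UNIV. (\<Sum>s\<in>UNIV. christoffel chi p j s z * H z $ s $ q) * V z $ q)" for p
    by (simp add: sum_distrib_left sum_distrib_right mult.assoc) (rule sum.swap)
  have S2: "(\<Sum>q\<in>UNIV. (\<Sum>s\<in>UNIV. christoffel chi s j q z * H z $ p $ s) * V z $ q) =
      (\<Sum>s\<in>UNIV. H z $ p $ s * (\<Sum>q\<in>UNIV. christoffel chi s j q z * V z $ q))" for p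
    by (simp add: sum_distrib_left sum_distrib_right ac_simps) (rule sum.swap)
  show ?thesis
    using S2
    by (simp add: vec_eq_iff nabla_vec_def nabla_end_def matrix_vector_mult_def W S1)
      (simp add: algebra_simps sum.distrib sum_subtractf)
qed

lemma nabla_bar_end_Leibniz:
  assumes "\<And>p q. (\<lambda>w. H w $ p $ q) differentiable (at z)"
    and "\<And>q. (\<lambda>w. V w $ q) differentiable (at z)"
  shows "nabla_bar_vec k (\<lambda>w. H w *v V w) z
    = nabla_bar_end k H z *v V z + H z *v nabla_bar_vec k V z"
  unfolding vec_eq_iff nabla_bar_vec_def nabla_bar_end_def matrix_vector_mult_def wirtinger_bar_def
  using assms
  by (simp add: frechet_derivative_sum_mult)
    (simp add: sum.distrib sum_distrib_left sum_divide_distrib algebra_simps add_divide_distrib)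


section \<open>The exterior derivative of the difference of two metrics\<close>

text \<open>
  In \<open>alpha chi g q p j\<close> the index \<open>q\<close> is barred; these are, up to a constant, the coefficients
  of the (2,1)-form obtained by applying the (1,0)-part of \<open>d\<close> to the difference of the metrics.
\<close>

definition alpha ::
  "(complex^'n \<Rightarrow> complex^'n^'n) \<Rightarrow> (complex^'n \<Rightarrow> complex^'n^'n) \<Rightarrow> 'n::finite \<Rightarrow> 'n \<Rightarrow> 'n \<Rightarrow> complex^'n \<Rightarrow> complex"
  where "alpha chi g q p j z =
    wirtinger j (\<lambda>w. g w $ q $ p - chi w $ q $ p) z - wirtinger p (\<lambda>w. g w $ q $ j - chi w $ q $ j) z"

definition alpha_form ::
  "(complex^'n \<Rightarrow> complex^'n^'n) \<Rightarrow> (complex^'n \<Rightarrow> complex^'n^'n) \<Rightarrow> 'n::finite \<Rightarrow> complex^'n \<Rightarrow> complex"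
  where "alpha_form chi g j z =
    (\<Sum>p\<in>UNIV. \<Sum>q\<in>UNIV. matrix_inv (chi z) $ p $ q * alpha chi g q p j z)"

end

theory Submission
  imports Defs
begin

text \<open>
  Since \<open>\<nabla>\<chi> = 0\<close>, lowering an index turns \<open>\<nabla>\<^sub>p h\<close> into \<open>\<nabla>\<^sub>p g\<close>.  Exchanging the derivative index
  with a tensor index of \<open>\<nabla>g\<close> costs terms in \<open>\<alpha>\<close> and the torsion.  Put \<open>D\<^sub>p = \<nabla>\<^sub>p g + g T\<^sub>p\<close>, where \<open>T\<^sub>p\<close> is the
  matrix with entries \<open>T\<close> with first lower index \<open>p\<close>.  After the exchange, the left hand side
  equals \<open>\<bar>\<partial> Tr h\<bar>\<^sup>2 / Tr h - \<bar>D\<bar>\<^sup>2 + \<bar>T\<bar>\<^sup>2 - Re \<langle>T, \<alpha>\<rangle>\<close>, and the \<open>\<chi>\<close>-contraction of \<open>D\<close> is the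
  1-form \<open>W\<close> with components \<open>\<partial>\<^sub>j Tr h - \<alpha>\<^sub>j + T\<^sub>j\<close>.  The Cauchy-Schwarz inequality
  \<open>\<bar>W\<bar>\<^sup>2 \<le> Tr h \<bar>D\<bar>\<^sup>2\<close> and expansion of \<open>\<bar>W\<bar>\<^sup>2\<close> give the claim.
\<close>

section \<open>Positive definite Hermitian matrices\<close>

text \<open>The Cholesky factorization; the induction step passes to the Schur complement \<open>M'\<close>.\<close>

lemma hermitian_factorization_on:
  fixes M :: "'i \<Rightarrow> 'i \<Rightarrow> complex"
  assumes "finite I"
    and "\<And>i j. i \<in> I \<Longrightarrow> j \<in> I \<Longrightarrow> M i j = cnj (M j i)"
    and "\<And>v. \<exists>i\<in>I. v i \<noteq> 0 \<Longrightarrow> 0 < Re (\<Sum>i\<in>I. \<Sum>j\<in>I. M i j * v j * cnj (v i))"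
  shows "\<exists>P. \<forall>i\<in>I. \<forall>j\<in>I. M i j = (\<Sum>a\<in>I. P i a * cnj (P j a))"
  using assms
proof (induction I arbitrary: M rule: finite_induct)
  case empty
  then show ?case by simp
next
  case (insert a I)
  have herm: "M i j = cnj (M j i)" if "i \<in> insert a I" "j \<in> insert a I" for i j
    using insert.prems(1) that by blast
  define c where "c = Re (M a a)"
  \<comment> \<open>The unit vector at \<open>a\<close>; positivity on it makes the pivot
    \<open>c\<close> positive.\<close>
  define e :: "'i \<Rightarrow> complex" where "e i = (if i = a then 1 else 0)" for i
  have "0 < Re (\<Sum>i\<in>insert a I. \<Sum>j\<in>insert a I. M i j * e j * cnj (e i))"
    by (rule insert.prems(2)) (simp add: e_def)
  moreover have "e a = 1" "\<And>i. i \<in> I \<Longrightarrow> e i = 0"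
    using insert.hyps by (auto simp: e_def)
  ultimately have c: "c > 0"
    using insert.hyps by (simp add: c_def)
  have Maa: "M a a = of_real c"
    using herm[of a a] by (simp add: c_def complex_eq_iff)
  have ca: "cnj (M a i) = M i a" if "i \<in> I" for i
    using herm[of i a] that by simp
  define M' where "M' i j = M i j - M i a * M a j / of_real c" for i j
  have 1: "M' i j = cnj (M' j i)" if "i \<in> I" "j \<in> I" for i j
    using herm[of i j] herm[of i a] herm[of j a] herm[of a i] herm[of a j] that
    by (simp add: M'_def)
  have 2: "0 < Re (\<Sum>i\<in>I. \<Sum>j\<in>I. M' i j * v j * cnj (v i))" if v: "\<exists>i\<in>I. v i \<noteq> 0" for v
  proof -
    define s where "s = (\<Sum>j\<in>I. M a j * v j)"
    \<comment> \<open>The entry at \<open>a\<close> completes the square: it minimizes the form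
      among the vectors that agree with \<open>v\<close> on \<open>I\<close>, and the minimum is the
      Schur form at \<open>v\<close>.\<close>
    define w where "w i = (if i = a then - s / of_real c else v i)" for i
    have cs: "cnj s = (\<Sum>i\<in>I. M i a * cnj (v i))"
      using ca by (simp add: s_def)
    have w: "w i = v i" if "i \<in> I" for i
      using that insert.hyps by (auto simp: w_def)
    have wa: "w a = - s / of_real c" by (simp add: w_def)
    have "(\<Sum>i\<in>insert a I. \<Sum>j\<in>insert a I. M i j * w j * cnj (w i))
       = M a a * w a * cnj (w a) + (\<Sum>j\<in>I. M a j * v j) * cnj (w a)
         + (\<Sum>i\<in>I. M i a * cnj (v i)) * w a + (\<Sum>i\<in>I. \<Sum>j\<in>I. M i j * v j * cnj (v i))"
      using insert.hyps
      by (simp add: w sum.distrib sum_distrib_left sum_distrib_right algebra_simps)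
    also have "\<dots> = (\<Sum>i\<in>I. \<Sum>j\<in>I. M i j * v j * cnj (v i)) - cnj s * s / of_real c"
      using c by (simp add: Maa wa flip: s_def cs)
    also have "cnj s * s = (\<Sum>i\<in>I. \<Sum>j\<in>I. M i a * M a j * v j * cnj (v i))"
      unfolding cs unfolding s_def sum_product by (simp add: ac_simps)
    also have "(\<Sum>i\<in>I. \<Sum>j\<in>I. M i j * v j * cnj (v i)) - \<dots> / of_real c
        = (\<Sum>i\<in>I. \<Sum>j\<in>I. M' i j * v j * cnj (v i))"
      by (simp add: M'_def sum_subtractf sum_divide_distrib left_diff_distrib)
    finally have eq: "(\<Sum>i\<in>insert a I. \<Sum>j\<in>insert a I. M i j * w j * cnj (w i))
        = (\<Sum>i\<in>I. \<Sum>j\<in>I. M' i j * v j * cnj (v i))" .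
    have "\<exists>i\<in>insert a I. w i \<noteq> 0" using v w by fastforce
    from insert.prems(2)[OF this] show ?thesis by (simp only: eq)
  qed
  obtain P where P: "\<And>i j. i \<in> I \<Longrightarrow> j \<in> I \<Longrightarrow> M' i j = (\<Sum>x\<in>I. P i x * cnj (P j x))"
    using insert.IH[OF 1 2] by blast
  \<comment> \<open>The new Cholesky column is column \<open>a\<close> of \<open>M\<close> divided
    by the square root of the pivot; the columns of \<open>P\<close> get a zero in row
    \<open>a\<close>.\<close>
  define R where "R i x = (if x = a then M i a / of_real (sqrt c) else if i = a then 0 else P i x)" for i x
  have "M i j = (\<Sum>x\<in>insert a I. R i x * cnj (R j x))" if "i \<in> insert a I" "j \<in> insert a I" for i j
  proof -
    have "of_real (sqrt c) * of_real (sqrt c) = (of_real c :: complex)"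
      using c by (simp flip: of_real_mult)
    then have Ra: "R i a * cnj (R j a) = M i a * M a j / of_real c"
      using herm[of a j] that by (simp add: R_def)
    have "(\<Sum>x\<in>I. R i x * cnj (R j x)) = (if i = a \<or> j = a then 0 else M' i j)"
      using that insert.hyps P by (auto simp: R_def intro!: sum.neutral sum.cong)
    then show ?thesis
      using insert.hyps c by (auto simp: Ra M'_def Maa)
  qed
  then show ?case by blast
qed

section \<open>Adjoints, inverses and traces of positive definite matrices\<close>

definition adjoint_mat :: "complex^'n^'m \<Rightarrow> complex^'m^'n"
  where "adjoint_mat M = (\<chi> i j. cnj (M $ j $ i))"

lemma adjoint_mat_nth [simp]: "adjoint_mat M $ i $ j = cnj (M $ j $ i)"
  by (simp add: adjoint_mat_def)

lemma adjoint_mat_adjoint_mat [simp]: "adjoint_mat (adjoint_mat M) = M"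
  by (simp add: vec_eq_iff)

lemma adjoint_mat_mult: "adjoint_mat (A ** B) = adjoint_mat B ** adjoint_mat A"
  by (simp add: vec_eq_iff matrix_matrix_mult_def mult.commute)

lemma adjoint_mat_one [simp]: "adjoint_mat (mat 1) = mat 1"
  by (simp add: vec_eq_iff mat_def)

lemma trace_adjoint_mat: "trace (adjoint_mat M) = cnj (trace M)"
  by (simp add: trace_def)

lemma matrix_inv_mult:
  fixes A :: "'a::semiring_1^'n^'n"
  assumes "invertible A"
  shows "A ** matrix_inv A = mat 1" "matrix_inv A ** A = mat 1"
  using someI_ex[OF assms[unfolded invertible_def]] by (simp_all add: matrix_inv_def)

lemma hermitian_posdef_adjoint: "hermitian_posdef M \<Longrightarrow> adjoint_mat M = M"
  unfolding hermitian_posdef_def vec_eq_iff adjoint_mat_nth by metis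

lemma hermitian_posdef_pos:
  "hermitian_posdef M \<Longrightarrow> v \<noteq> 0 \<Longrightarrow>
    0 < Re (\<Sum>k\<in>UNIV. \<Sum>j\<in>UNIV. M $ k $ j * v $ j * cnj (v $ k))"
  unfolding hermitian_posdef_def by blast

text \<open>The quadratic form vanishes on a kernel vector, so the kernel is trivial.\<close>

lemma hermitian_posdef_invertible:
  fixes M :: "complex^'n::finite^'n"
  assumes "hermitian_posdef M"
  shows "invertible M"
proof -
  have "v = 0" if "M *v v = 0" for v
  proof (rule ccontr)
    assume "v \<noteq> 0"
    then have "0 < Re (\<Sum>k\<in>UNIV. \<Sum>j\<in>UNIV. M $ k $ j * v $ j * cnj (v $ k))"
      by (rule hermitian_posdef_pos[OF assms])
    also have "(\<Sum>k\<in>UNIV. \<Sum>j\<in>UNIV. M $ k $ j * v $ j * cnj (v $ k))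
        = (\<Sum>k\<in>UNIV. (M *v v) $ k * cnj (v $ k))"
      by (simp add: matrix_vector_mult_def sum_distrib_right)
    finally show False by (simp add: that)
  qed
  then show ?thesis
    by (simp add: invertible_left_inverse matrix_left_invertible_ker)
qed

lemma hermitian_posdef_inv_adjoint:
  fixes M :: "complex^'n::finite^'n"
  assumes "hermitian_posdef M"
  shows "adjoint_mat (matrix_inv M) = matrix_inv M"
proof -
  note inv = matrix_inv_mult[OF hermitian_posdef_invertible[OF assms]]
  have "adjoint_mat (matrix_inv M) ** M = mat 1"
    using arg_cong[OF inv(1), of adjoint_mat]
    by (simp add: adjoint_mat_mult hermitian_posdef_adjoint[OF assms])
  then have "adjoint_mat (matrix_inv M) ** M ** matrix_inv M = matrix_inv M" by simp
  then show ?thesis by (simp add: inv flip: matrix_mul_assoc)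
qed

text \<open>The inverse is again positive definite, so Cholesky applies to it. These factors later
  turn traces and pairings into sums of squares.\<close>

lemma hermitian_posdef_inv_factorization:
  fixes M :: "complex^'n::finite^'n"
  assumes "hermitian_posdef M"
  obtains P :: "complex^'n^'n" where "matrix_inv M = P ** adjoint_mat P"
proof -
  note inv = matrix_inv_mult[OF hermitian_posdef_invertible[OF assms]]
  let ?N = "matrix_inv M"
  have cN: "cnj (?N $ i $ j) = ?N $ j $ i" for i j
    using arg_cong[OF hermitian_posdef_inv_adjoint[OF assms], of "\<lambda>A. A $ j $ i"] by simp
  have "\<exists>P :: 'n \<Rightarrow> 'n \<Rightarrow> complex. \<forall>i\<in>UNIV. \<forall>j\<in>UNIV. ?N $ i $ j = (\<Sum>a\<in>UNIV. P i a * cnj (P j a))"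
  proof (rule hermitian_factorization_on[of UNIV "\<lambda>i j. ?N $ i $ j"])
    fix v :: "'n \<Rightarrow> complex"
    assume v: "\<exists>i\<in>UNIV. v i \<noteq> 0"
    \<comment> \<open>The form of the inverse at \<open>v\<close> equals the form of
      \<open>M\<close> at \<open>u\<close>.\<close>
    define u where "u = ?N *v (\<chi> i. v i)"
    have Mu: "M *v u = (\<chi> i. v i)"
      by (simp add: u_def matrix_vector_mul_assoc inv)
    have "u \<noteq> 0"
    proof
      assume "u = 0"
      with Mu have "(\<chi> i. v i) = (0 :: complex^'n)" by simp
      with v show False by (simp add: vec_eq_iff)
    qed
    then have "0 < Re (\<Sum>k\<in>UNIV. \<Sum>j\<in>UNIV. M $ k $ j * u $ j * cnj (u $ k))"
      by (rule hermitian_posdef_pos[OF assms])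
    also have "(\<Sum>k\<in>UNIV. \<Sum>j\<in>UNIV. M $ k $ j * u $ j * cnj (u $ k))
        = (\<Sum>k\<in>UNIV. (M *v u) $ k * cnj (u $ k))"
      by (simp add: matrix_vector_mult_def sum_distrib_right)
    also have "\<dots> = (\<Sum>k\<in>UNIV. \<Sum>i\<in>UNIV. ?N $ i $ k * v k * cnj (v i))"
      unfolding Mu by (simp add: u_def matrix_vector_mult_def cN sum_distrib_left ac_simps)
    also have "\<dots> = (\<Sum>i\<in>UNIV. \<Sum>j\<in>UNIV. ?N $ i $ j * v j * cnj (v i))"
      by (rule sum.swap)
    finally show "0 < Re (\<Sum>i\<in>UNIV. \<Sum>j\<in>UNIV. ?N $ i $ j * v j * cnj (v i))" .
  qed (simp_all add: cN)
  then obtain P :: "'n \<Rightarrow> 'n \<Rightarrow> complex" where "\<And>i j. ?N $ i $ j = (\<Sum>a\<in>UNIV. P i a * cnj (P j a))" by blast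
  then have "?N = (\<chi> i a. P i a) ** adjoint_mat (\<chi> i a. P i a)"
    by (simp add: vec_eq_iff matrix_matrix_mult_def)
  then show thesis by (rule that)
qed

text \<open>The trace is real by self-adjointness and cyclicity. Factoring the inverse of
  \<open>C\<close> and cycling gives the sum of the \<open>G\<close>-form over the columns of
  \<open>P\<close>.\<close>

lemma trace_inv_mult_pos:
  fixes C G :: "complex^'n::finite^'n"
  assumes C: "hermitian_posdef C" and G: "hermitian_posdef G"
  shows "Im (trace (matrix_inv C ** G)) = 0" "0 < Re (trace (matrix_inv C ** G))"
proof -
  have "cnj (trace (matrix_inv C ** G)) = trace (matrix_inv C ** G)"
    unfolding trace_adjoint_mat[symmetric] adjoint_mat_mult
    by (simp add: hermitian_posdef_inv_adjoint[OF C] hermitian_posdef_adjoint[OF G])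
       (rule trace_mul_sym)
  then show "Im (trace (matrix_inv C ** G)) = 0" by (simp add: complex_eq_iff)
  obtain P :: "complex^'n^'n" where P: "matrix_inv C = P ** adjoint_mat P"
    using hermitian_posdef_inv_factorization[OF C] .
  let ?q = "\<lambda>a. \<Sum>k\<in>UNIV. \<Sum>j\<in>UNIV. G $ k $ j * column a P $ j * cnj (column a P $ k)"
  have "trace (matrix_inv C ** G) = trace (adjoint_mat P ** (G ** P))"
    unfolding P by (metis trace_mul_sym matrix_mul_assoc)
  also have "\<dots> = (\<Sum>a\<in>UNIV. ?q a)"
    by (simp add: trace_def matrix_matrix_mult_def column_def sum_distrib_left ac_simps)
  finally have eq: "Re (trace (matrix_inv C ** G)) = (\<Sum>a\<in>UNIV. Re (?q a))" by simp
  \<comment> \<open>Strict positivity needs a nonzero column; without one the inverse of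
    \<open>C\<close> would be zero.\<close>
  have "\<exists>a. column a P \<noteq> 0"
  proof (rule ccontr)
    assume "\<not> (\<exists>a. column a P \<noteq> 0)"
    then have "P = 0" by (simp add: vec_eq_iff column_def)
    then have "matrix_inv C = 0" by (simp add: P vec_eq_iff matrix_matrix_mult_def)
    then have "(mat 1 :: complex^'n^'n) = 0"
      using matrix_inv_mult(1)[OF hermitian_posdef_invertible[OF C]]
      by (simp add: vec_eq_iff matrix_matrix_mult_def)
    \<comment> \<open>Here \<open>undefined\<close> is an arbitrary index: any diagonal entry gives
      1 = 0.\<close>
    from arg_cong[OF this, of "\<lambda>A. A $ undefined $ undefined"] show False by (simp add: mat_def)
  qed
  then obtain a where a: "column a P \<noteq> 0" ..
  have nn: "0 \<le> Re (?q b)" for b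
    using hermitian_posdef_pos[OF G, of "column b P"]
    by (cases "column b P = 0") (simp, rule less_imp_le)
  show "0 < Re (trace (matrix_inv C ** G))"
    unfolding eq
    by (rule sum_pos2[of _ a]) (use hermitian_posdef_pos[OF G a] nn in simp_all)
qed

section \<open>Wirtinger derivatives of matrices\<close>

lemma matrix_diff_ldistrib:
  fixes A :: "'a::ring_1^'n^'m"
  shows "A ** (B - C) = A ** B - A ** C"
  by (simp add: vec_eq_iff matrix_matrix_mult_def right_diff_distrib sum_subtractf)

section \<open>Differentiability of determinants and inverse matrices\<close>

lemma smooth_fun_on_differentiable:
  assumes "smooth_fun_on f S" "z \<in> S"
  shows "f differentiable (at z)"
proof -
  have "Ck_on (Suc 0) f S" using assms(1) unfolding smooth_fun_on_def by blast
  then show ?thesis using assms(2) by simp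
qed

lemma differentiable_prod:
  fixes f :: "'i \<Rightarrow> 'a::real_normed_vector \<Rightarrow> 'b::real_normed_field"
  assumes "\<And>i. i \<in> I \<Longrightarrow> f i differentiable (at z)"
  shows "(\<lambda>w. \<Prod>i\<in>I. f i w) differentiable (at z)"
proof -
  have "\<forall>i\<in>I. \<exists>D. (f i has_derivative D) (at z)"
    using assms by (simp add: differentiable_def)
  from bchoice[OF this] obtain D where "\<And>i. i \<in> I \<Longrightarrow> (f i has_derivative D i) (at z)" by blast
  from has_derivative_prod[OF this] show ?thesis by (rule differentiableI)
qed

lemma differentiable_det:
  fixes M :: "'a::real_normed_vector \<Rightarrow> complex^'n::finite^'n"
  assumes "\<And>i j. (\<lambda>w. M w $ i $ j) differentiable (at z)"
  shows "(\<lambda>w. det (M w)) differentiable (at z)"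
  unfolding det_def
  by (intro differentiable_sum ballI differentiable_mult differentiable_const differentiable_prod
        finite_permutations finite assms)

lemma differentiable_transform_open:
  assumes "f differentiable (at z)" "open S" "z \<in> S" "\<And>w. w \<in> S \<Longrightarrow> f w = g w"
  shows "g differentiable (at z)"
  using assms has_derivative_transform_within_open[of f _ z UNIV S g]
  unfolding differentiable_def by auto

text \<open>Column \<open>l\<close> of the inverse solves the linear system with right-hand side
  \<open>axis l 1\<close>. The resulting quotient of determinants can be differentiated.\<close>

lemma matrix_inv_cramer:
  fixes A :: "complex^'n::finite^'n"
  assumes "invertible A"
  shows "matrix_inv A $ k $ l = det (\<chi> i j. if j = k then axis l 1 $ i else A $ i $ j) / det A"
proof -
  have *: "(matrix_inv A *v axis l 1) $ k = matrix_inv A $ k $ l"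
    by (simp add: matrix_vector_mult_def axis_def if_distrib cong: if_cong)
  have "A *v (matrix_inv A *v axis l 1) = axis l 1"
    by (simp add: matrix_vector_mul_assoc matrix_inv_mult[OF assms])
  moreover have "det A \<noteq> 0" using assms by (simp add: invertible_det_nz)
  ultimately have "matrix_inv A *v axis l 1
      = (\<chi> k. det (\<chi> i j. if j = k then axis l 1 $ i else A $ i $ j) / det A)"
    by (subst (asm) cramer)
  from arg_cong[OF this, of "\<lambda>v. v $ k"] show ?thesis
    by (simp only: *) simp
qed

text \<open>Invertibility on a neighbourhood lets Cramer's formula replace \<open>matrix_inv\<close>
  near \<open>z\<close>.\<close>

lemma differentiable_matrix_inv:
  fixes M :: "complex^'m \<Rightarrow> complex^'n::finite^'n"
  assumes diff: "\<And>i j. (\<lambda>w. M w $ i $ j) differentiable (at z)"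
    and "open S" "z \<in> S" and inv: "\<And>w. w \<in> S \<Longrightarrow> invertible (M w)"
  shows "(\<lambda>w. matrix_inv (M w) $ k $ l) differentiable (at z)"
proof (rule differentiable_transform_open[OF _ assms(2,3)])
  show "(\<lambda>w. det (\<chi> i j. if j = k then axis l 1 $ i else M w $ i $ j) / det (M w)) differentiable (at z)"
  proof (intro differentiable_divide differentiable_det diff)
    show "det (M z) \<noteq> 0" using inv[OF assms(3)] by (simp add: invertible_det_nz)
    show "(\<lambda>w. (\<chi> i j. if j = k then axis l 1 $ i else M w $ i $ j) $ i $ j) differentiable (at z)" for i j
      using diff by (cases "j = k") simp_all
  qed
qed (simp add: matrix_inv_cramer inv)

section \<open>Rules for Wirtinger derivatives of scalar functions\<close>

lemma wirtinger_cong: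
  assumes "f differentiable (at z)" "open S" "z \<in> S" "\<And>w. w \<in> S \<Longrightarrow> f w = g w"
  shows "wirtinger j f z = wirtinger j g z" "wirtinger_bar j f z = wirtinger_bar j g z"
  using frechet_derivative_transform_within_open[OF assms]
  by (simp_all add: wirtinger_def wirtinger_bar_def)

lemma wirtinger_diff:
  assumes "f differentiable (at z)" "g differentiable (at z)"
  shows "wirtinger j (\<lambda>w. f w - g w) z = wirtinger j f z - wirtinger j g z"
proof -
  have "frechet_derivative (\<lambda>w. f w - g w) (at z)
      = (\<lambda>v. frechet_derivative f (at z) v - frechet_derivative g (at z) v)"
    using assms
    by (intro frechet_derivative_at[symmetric] has_derivative_diff)
       (simp_all flip: frechet_derivative_works)
  then show ?thesis by (simp add: wirtinger_def field_simps)
qed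

lemma frechet_derivative_sum:
  fixes f :: "'i::finite \<Rightarrow> complex^'n \<Rightarrow> complex"
  assumes "\<And>i. f i differentiable (at z)"
  shows "frechet_derivative (\<lambda>w. \<Sum>i\<in>UNIV. f i w) (at z)
    = (\<lambda>v. \<Sum>i\<in>UNIV. frechet_derivative (f i) (at z) v)"
  using assms
  by (intro frechet_derivative_at[symmetric] has_derivative_sum)
     (simp_all flip: frechet_derivative_works)

lemma wirtinger_sum:
  fixes f :: "'i::finite \<Rightarrow> complex^'n \<Rightarrow> complex"
  assumes "\<And>i. f i differentiable (at z)"
  shows "wirtinger j (\<lambda>w. \<Sum>i\<in>UNIV. f i w) z = (\<Sum>i\<in>UNIV. wirtinger j (f i) z)"
    and "wirtinger_bar j (\<lambda>w. \<Sum>i\<in>UNIV. f i w) z = (\<Sum>i\<in>UNIV. wirtinger_bar j (f i) z)"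
  using frechet_derivative_sum[of f, OF assms]
  by (simp_all add: wirtinger_def wirtinger_bar_def sum_distrib_left sum_subtractf sum.distrib
      flip: sum_divide_distrib)

lemma wirtinger_bar_cnj:
  assumes "f differentiable (at z)"
  shows "wirtinger_bar j (\<lambda>w. cnj (f w)) z = cnj (wirtinger j f z)"
proof -
  have "frechet_derivative (\<lambda>w. cnj (f w)) (at z) = (\<lambda>v. cnj (frechet_derivative f (at z) v))"
    using assms
    by (intro frechet_derivative_at[symmetric] has_derivative_cnj)
       (simp_all flip: frechet_derivative_works)
  then show ?thesis by (simp add: wirtinger_def wirtinger_bar_def)
qed

section \<open>Matrix form of the derivatives and of the connection\<close>

definition wirtinger_mat :: "'n::finite \<Rightarrow> (complex^'n \<Rightarrow> complex^'m^'l) \<Rightarrow> complex^'n \<Rightarrow> complex^'m^'l"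
  where "wirtinger_mat j M z = (\<chi> p q. wirtinger j (\<lambda>w. M w $ p $ q) z)"

definition christoffel_mat ::
  "(complex^'n \<Rightarrow> complex^'n^'n) \<Rightarrow> 'n::finite \<Rightarrow> complex^'n \<Rightarrow> complex^'n^'n"
  where "christoffel_mat chi j z = (\<chi> p q. christoffel chi p j q z)"

lemma christoffel_mat_eq: "christoffel_mat chi j z = matrix_inv (chi z) ** wirtinger_mat j chi z"
  by (simp add: christoffel_mat_def vec_eq_iff christoffel_def wirtinger_mat_def matrix_matrix_mult_def)

text \<open>The connection enters through a commutator, which has trace zero.\<close>

lemma nabla_end_eq:
  "nabla_end chi j H z
    = wirtinger_mat j H z + christoffel_mat chi j z ** H z - H z ** christoffel_mat chi j z"
  by (simp add: vec_eq_iff nabla_end_def wirtinger_mat_def christoffel_mat_def matrix_matrix_mult_def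
      mult.commute)

lemma
  fixes M N :: "complex^'n \<Rightarrow> complex^'m::finite^'m"
  assumes "\<And>p q. (\<lambda>w. M w $ p $ q) differentiable (at z)"
    and "\<And>p q. (\<lambda>w. N w $ p $ q) differentiable (at z)"
  shows wirtinger_mat_mult: "wirtinger_mat j (\<lambda>w. M w ** N w) z
      = wirtinger_mat j M z ** N z + M z ** wirtinger_mat j N z"
    and wirtinger_bar_mat_mult: "wirtinger_bar j (\<lambda>w. (M w ** N w) $ p $ q) z
      = (\<Sum>r\<in>UNIV. wirtinger_bar j (\<lambda>w. M w $ p $ r) z * N z $ r $ q)
      + (\<Sum>r\<in>UNIV. M z $ p $ r * wirtinger_bar j (\<lambda>w. N w $ r $ q) z)"
proof -
  show "wirtinger_mat j (\<lambda>w. M w ** N w) z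
      = wirtinger_mat j M z ** N z + M z ** wirtinger_mat j N z"
    using assms
    by (simp add: vec_eq_iff wirtinger_mat_def matrix_matrix_mult_def wirtinger_def
        frechet_derivative_sum_mult)
      (simp add: sum.distrib sum_distrib_left sum_subtractf
        sum_divide_distrib algebra_simps diff_divide_distrib add_divide_distrib)
  show "wirtinger_bar j (\<lambda>w. (M w ** N w) $ p $ q) z
      = (\<Sum>r\<in>UNIV. wirtinger_bar j (\<lambda>w. M w $ p $ r) z * N z $ r $ q)
      + (\<Sum>r\<in>UNIV. M z $ p $ r * wirtinger_bar j (\<lambda>w. N w $ r $ q) z)"
    using assms
    by (simp add: matrix_matrix_mult_def wirtinger_bar_def frechet_derivative_sum_mult)
      (simp add: sum.distrib sum_distrib_left
        sum_divide_distrib algebra_simps add_divide_distrib)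
qed

text \<open>Conjugation exchanges the two Wirtinger derivatives while Hermitian symmetry exchanges
  the indices. The symmetry is required near \<open>z\<close> because it is differentiated.\<close>

lemma wirtinger_bar_hermitian:
  fixes M :: "complex^'n \<Rightarrow> complex^'m::finite^'m"
  assumes "\<And>p q. (\<lambda>w. M w $ p $ q) differentiable (at z)"
    and "open S" "z \<in> S" and "\<And>w. w \<in> S \<Longrightarrow> adjoint_mat (M w) = M w"
  shows "wirtinger_bar j (\<lambda>w. M w $ p $ q) z = adjoint_mat (wirtinger_mat j M z) $ p $ q"
proof -
  have "wirtinger_bar j (\<lambda>w. M w $ p $ q) z = wirtinger_bar j (\<lambda>w. cnj (M w $ q $ p)) z"
  proof (rule wirtinger_cong(2)[OF assms(1-3)])
    show "M w $ p $ q = cnj (M w $ q $ p)" if "w \<in> S" for w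
      using arg_cong[OF assms(4)[OF that], of "\<lambda>A. A $ p $ q"] by simp
  qed
  also have "\<dots> = cnj (wirtinger j (\<lambda>w. M w $ q $ p) z)"
    by (rule wirtinger_bar_cnj[OF assms(1)])
  finally show ?thesis by (simp add: wirtinger_mat_def)
qed

section \<open>Hermitian pairings of tensors\<close>

text \<open>Moves the outermost sum innermost; long contractions are reordered by repeated
  use.\<close>

lemma sum_rotate3:
  "(\<Sum>r\<in>A. \<Sum>j\<in>B. \<Sum>k\<in>C. f r j k) = (\<Sum>j\<in>B. \<Sum>k\<in>C. \<Sum>r\<in>A. f r j k)"
  by (subst sum.swap) (intro sum.cong refl sum.swap)

text \<open>Sesquilinear contraction of three-index tensors: \<open>K\<close> contracts the matrix
  labels and \<open>L\<close> the column indices. The row index is summed directly, so it is raised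
  in one argument and lowered in the other; a factor such as \<open>L **\<close> or
  \<open>chi z **\<close> adjusts its position.\<close>

definition pairing ::
  "complex^'n::finite^'n \<Rightarrow> complex^'n^'n \<Rightarrow> ('n \<Rightarrow> complex^'n^'n) \<Rightarrow> ('n \<Rightarrow> complex^'n^'n) \<Rightarrow> complex"
  where "pairing K L X Y =
    (\<Sum>p\<in>UNIV. \<Sum>q\<in>UNIV. K $ p $ q * trace (X p ** L ** adjoint_mat (Y q)))"

definition form_pairing ::
  "complex^'n::finite^'n \<Rightarrow> ('n \<Rightarrow> complex) \<Rightarrow> ('n \<Rightarrow> complex) \<Rightarrow> complex"
  where "form_pairing L u v = (\<Sum>j\<in>UNIV. \<Sum>k\<in>UNIV. L $ j $ k * u j * cnj (v k))"

lemma form_pairing_linear: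
  "form_pairing L (\<lambda>j. u j + v j) w = form_pairing L u w + form_pairing L v w"
  "form_pairing L (\<lambda>j. u j - v j) w = form_pairing L u w - form_pairing L v w"
  "form_pairing L (\<lambda>j. u j / c) w = form_pairing L u w / c"
  "form_pairing L w (\<lambda>j. u j + v j) = form_pairing L w u + form_pairing L w v"
  "form_pairing L w (\<lambda>j. u j - v j) = form_pairing L w u - form_pairing L w v"
  by (simp_all add: form_pairing_def algebra_simps sum.distrib sum_subtractf sum_divide_distrib)

lemma form_pairing_cnj:
  assumes "adjoint_mat L = L"
  shows "cnj (form_pairing L u v) = form_pairing L v u"
proof -
  have "cnj (L $ j $ k) = L $ k $ j" for j k
    using arg_cong[OF assms, of "\<lambda>A. A $ k $ j"] by simp
  then have "cnj (form_pairing L u v) = (\<Sum>j\<in>UNIV. \<Sum>k\<in>UNIV. L $ k $ j * v k * cnj (u j))"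
    by (simp add: form_pairing_def ac_simps)
  then show ?thesis unfolding form_pairing_def by (simp only:) (rule sum.swap)
qed

lemma pairing_expand:
  "pairing K L X Y = (\<Sum>p\<in>UNIV. \<Sum>q\<in>UNIV. \<Sum>r\<in>UNIV. \<Sum>j\<in>UNIV. \<Sum>k\<in>UNIV.
     K $ p $ q * X p $ r $ j * L $ j $ k * cnj (Y q $ r $ k))"
proof -
  have "trace (X p ** L ** adjoint_mat (Y q))
      = (\<Sum>r\<in>UNIV. \<Sum>j\<in>UNIV. \<Sum>k\<in>UNIV. X p $ r $ j * L $ j $ k * cnj (Y q $ r $ k))" for p q
    unfolding trace_def matrix_matrix_mult_def
    by (simp add: sum_distrib_right) (intro sum.cong refl sum.swap)
  then show ?thesis by (simp add: pairing_def sum_distrib_left mult.assoc)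
qed

lemma pairing_expand_mult:
  "pairing K L (\<lambda>p. M ** X p) Y =
    (\<Sum>p\<in>UNIV. \<Sum>q\<in>UNIV. \<Sum>s\<in>UNIV. \<Sum>r\<in>UNIV. \<Sum>j\<in>UNIV. \<Sum>k\<in>UNIV.
     K $ p $ q * M $ s $ r * L $ j $ k * X p $ r $ j * cnj (Y q $ s $ k))"
proof -
  have "(\<Sum>j\<in>UNIV. \<Sum>k\<in>UNIV. K $ p $ q * (M ** X p) $ s $ j * L $ j $ k * cnj (Y q $ s $ k))
      = (\<Sum>r\<in>UNIV. \<Sum>j\<in>UNIV. \<Sum>k\<in>UNIV. K $ p $ q * M $ s $ r * L $ j $ k * X p $ r $ j * cnj (Y q $ s $ k))"
    (is "?l = ?r") for p q s
  proof -
    have "?l = (\<Sum>j\<in>UNIV. \<Sum>r\<in>UNIV. \<Sum>k\<in>UNIV. K $ p $ q * M $ s $ r * L $ j $ k * X p $ r $ j * cnj (Y q $ s $ k))"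
      unfolding matrix_matrix_mult_def
      by (simp add: sum_distrib_left sum_distrib_right)
         (intro sum.cong refl, subst sum.swap, simp add: ac_simps)
    also have "\<dots> = ?r" by (rule sum.swap)
    finally show ?thesis .
  qed
  then show ?thesis unfolding pairing_expand by simp
qed

lemma pairing_linear:
  "pairing K L (\<lambda>p. X p + Y p) Z = pairing K L X Z + pairing K L Y Z"
  "pairing K L (\<lambda>p. X p - Y p) Z = pairing K L X Z - pairing K L Y Z"
  "pairing K L Z (\<lambda>p. X p + Y p) = pairing K L Z X + pairing K L Z Y"
  "pairing K L Z (\<lambda>p. X p - Y p) = pairing K L Z X - pairing K L Z Y"
  by (simp_all add: pairing_expand algebra_simps sum.distrib sum_subtractf)

text \<open>Cyclicity of the trace carries a matrix acting on the row index over to the other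
  argument.\<close>

lemma pairing_mult_left:
  "pairing K L (\<lambda>p. M ** X p) Y = pairing K L X (\<lambda>q. adjoint_mat M ** Y q)"
proof -
  have "trace (M ** X p ** L ** adjoint_mat (Y q)) = trace (X p ** L ** adjoint_mat (adjoint_mat M ** Y q))"
    for p q
    using trace_mul_sym[of M "X p ** L ** adjoint_mat (Y q)"]
    by (simp add: adjoint_mat_mult matrix_mul_assoc)
  then show ?thesis by (simp add: pairing_def)
qed

lemma pairing_cnj:
  assumes "adjoint_mat K = K" "adjoint_mat L = L"
  shows "cnj (pairing K L X Y) = pairing K L Y X"
proof -
  have K: "cnj (K $ p $ q) = K $ q $ p" for p q
    using arg_cong[OF assms(1), of "\<lambda>A. A $ q $ p"] by simp
  have "cnj (trace (X p ** L ** adjoint_mat (Y q))) = trace (Y q ** L ** adjoint_mat (X p))" for p q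
    unfolding trace_adjoint_mat[symmetric] by (simp add: adjoint_mat_mult assms matrix_mul_assoc)
  then have "cnj (pairing K L X Y) = (\<Sum>p\<in>UNIV. \<Sum>q\<in>UNIV. K $ q $ p * trace (Y q ** L ** adjoint_mat (X p)))"
    by (simp add: pairing_def K)
  then show ?thesis unfolding pairing_def by (simp only:) (rule sum.swap)
qed

text \<open>The Cholesky factors pass to orthonormal frames, where the pairing is a sum of squared
  absolute values.\<close>

lemma pairing_nonneg:
  assumes K: "K = P ** adjoint_mat P" and L: "L = Q ** adjoint_mat Q"
  shows "0 \<le> Re (pairing K L (\<lambda>p. L ** X p) X)"
proof -
  \<comment> \<open>Components in the frames: \<open>P\<close> acts on the matrix label,
    \<open>Q\<close> on the row and column indices.\<close>
  define F where "F a = (\<chi> r s. \<Sum>p\<in>UNIV. P $ p $ a * (adjoint_mat Q ** X p ** Q) $ r $ s)" for a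
  have F: "trace (F a ** adjoint_mat (F a)) = (\<Sum>p\<in>UNIV. \<Sum>q\<in>UNIV.
      P $ p $ a * cnj (P $ q $ a) * trace (L ** X p ** L ** adjoint_mat (X q)))" for a
  proof -
    let ?Y = "\<lambda>p. adjoint_mat Q ** X p ** Q"
    have tr: "trace (L ** X p ** L ** adjoint_mat (X q)) = trace (?Y p ** adjoint_mat (?Y q))" for p q
      using trace_mul_sym[of Q "adjoint_mat Q ** X p ** Q ** adjoint_mat Q ** adjoint_mat (X q)"]
      by (simp add: L adjoint_mat_mult matrix_mul_assoc)
    have "trace (F a ** adjoint_mat (F a)) = (\<Sum>r\<in>UNIV. \<Sum>s\<in>UNIV. \<Sum>p\<in>UNIV. \<Sum>q\<in>UNIV.
        P $ p $ a * cnj (P $ q $ a) * (?Y p $ r $ s * cnj (?Y q $ r $ s)))"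
      unfolding trace_def matrix_matrix_mult_def[of "F a"]
      by (simp add: F_def sum_product ac_simps)
    also have "\<dots> = (\<Sum>r\<in>UNIV. \<Sum>p\<in>UNIV. \<Sum>q\<in>UNIV. \<Sum>s\<in>UNIV.
        P $ p $ a * cnj (P $ q $ a) * (?Y p $ r $ s * cnj (?Y q $ r $ s)))"
      by (subst sum.swap, subst (2) sum.swap) (rule refl)
    also have "\<dots> = (\<Sum>p\<in>UNIV. \<Sum>q\<in>UNIV. \<Sum>r\<in>UNIV. \<Sum>s\<in>UNIV.
        P $ p $ a * cnj (P $ q $ a) * (?Y p $ r $ s * cnj (?Y q $ r $ s)))"
      by (subst sum.swap, subst (2) sum.swap) (rule refl)
    also have "\<dots> = (\<Sum>p\<in>UNIV. \<Sum>q\<in>UNIV.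
        P $ p $ a * cnj (P $ q $ a) * trace (L ** X p ** L ** adjoint_mat (X q)))"
      unfolding tr by (simp add: trace_def matrix_matrix_mult_def[of _ "adjoint_mat _"] sum_distrib_left)
    finally show ?thesis .
  qed
  have "pairing K L (\<lambda>p. L ** X p) X = (\<Sum>p\<in>UNIV. \<Sum>q\<in>UNIV. \<Sum>a\<in>UNIV.
      P $ p $ a * cnj (P $ q $ a) * trace (L ** X p ** L ** adjoint_mat (X q)))"
    by (simp add: pairing_def K matrix_matrix_mult_def[of P] sum_distrib_right)
  also have "\<dots> = (\<Sum>p\<in>UNIV. \<Sum>a\<in>UNIV. \<Sum>q\<in>UNIV.
      P $ p $ a * cnj (P $ q $ a) * trace (L ** X p ** L ** adjoint_mat (X q)))"
    by (intro sum.cong refl sum.swap)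
  also have "\<dots> = (\<Sum>a\<in>UNIV. trace (F a ** adjoint_mat (F a)))"
    unfolding F by (rule sum.swap)
  also have "\<dots> = (\<Sum>a\<in>UNIV. \<Sum>r\<in>UNIV. \<Sum>s\<in>UNIV. of_real ((norm (F a $ r $ s))\<^sup>2))"
    by (simp add: trace_def matrix_matrix_mult_def complex_norm_square flip: of_real_power)
  finally show ?thesis by (simp add: sum_nonneg)
qed

text \<open>
  Obtained by expanding \<open>0 \<le> \<bar>D - E\<bar>\<^sup>2\<close> for the tensor \<open>E\<close> with components
  \<open>G\<^bsub>sp\<^esub> W\<^sub>j / Tr h\<close>, the multiple of \<open>G \<otimes> W\<close> closest to \<open>D\<close>.
\<close>

lemma contraction_Cauchy_Schwarz:
  fixes C G :: "complex^'n::finite^'n" and D :: "'n \<Rightarrow> complex^'n^'n"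
  assumes C: "hermitian_posdef C" and G: "hermitian_posdef G"
  defines "K \<equiv> matrix_inv C" and "L \<equiv> matrix_inv G"
  defines "W \<equiv> \<lambda>j. \<Sum>p\<in>UNIV. \<Sum>s\<in>UNIV. K $ p $ s * D p $ s $ j"
  shows "Re (form_pairing L W W) \<le> Re (trace (K ** G)) * Re (pairing K L (\<lambda>p. L ** D p) D)"
proof -
  note Gi = matrix_inv_mult[OF hermitian_posdef_invertible[OF G], folded L_def]
  have adj: "adjoint_mat K = K" "adjoint_mat L = L" "adjoint_mat G = G"
    by (simp_all add: K_def L_def hermitian_posdef_inv_adjoint hermitian_posdef_adjoint C G)
  have cG: "cnj (G $ s $ q) = G $ q $ s" for q s
    using arg_cong[OF adj(3), of "\<lambda>A. A $ q $ s"] by simp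
  obtain t where t: "trace (K ** G) = of_real t" "t > 0"
    using trace_inv_mult_pos[OF C G] unfolding K_def by (metis complex_is_Real_iff of_real_Re)
  define E where "E p = (\<chi> s j. G $ s $ p * (W j / of_real t))" for p
  \<comment> \<open>Raising the row index of \<open>E\<close> leaves a Kronecker delta, so pairing
    it with \<open>X\<close> only sees the \<open>K\<close>-contraction of \<open>X\<close>.\<close>
  have LE: "(L ** E p) $ r $ j = (if r = p then W j / of_real t else 0)" for p r j
  proof -
    have "(L ** E p) $ r $ j = (L ** G) $ r $ p * (W j / of_real t)"
      by (simp add: E_def matrix_matrix_mult_def sum_distrib_right sum_divide_distrib mult.assoc)
    then show ?thesis by (simp add: Gi mat_def)
  qed
  have ED: "pairing K L (\<lambda>p. L ** E p) X
      = (\<Sum>j\<in>UNIV. \<Sum>k\<in>UNIV. L $ j $ k * (W j / of_real t) *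
           cnj (\<Sum>q\<in>UNIV. \<Sum>p\<in>UNIV. K $ q $ p * X q $ p $ k))" for X
  proof -
    have cK: "cnj (K $ q $ p) = K $ p $ q" for p q
      using arg_cong[OF adj(1), of "\<lambda>A. A $ p $ q"] by simp
    have "(\<Sum>r\<in>UNIV. \<Sum>j\<in>UNIV. \<Sum>k\<in>UNIV. K $ p $ q * (L ** E p) $ r $ j * L $ j $ k * cnj (X q $ r $ k))
        = (\<Sum>j\<in>UNIV. \<Sum>k\<in>UNIV. K $ p $ q * (W j / of_real t) * L $ j $ k * cnj (X q $ p $ k))" for p q
      by (subst sum.remove[of _ p]) (simp_all add: LE)
    then have "pairing K L (\<lambda>p. L ** E p) X = (\<Sum>p\<in>UNIV. \<Sum>q\<in>UNIV. \<Sum>j\<in>UNIV. \<Sum>k\<in>UNIV.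
       K $ p $ q * (W j / of_real t) * L $ j $ k * cnj (X q $ p $ k))"
      by (simp add: pairing_expand)
    also have "\<dots> = (\<Sum>q\<in>UNIV. \<Sum>p\<in>UNIV. \<Sum>j\<in>UNIV. \<Sum>k\<in>UNIV.
       K $ p $ q * (W j / of_real t) * L $ j $ k * cnj (X q $ p $ k))"
      by (rule sum.swap)
    also have "\<dots> = (\<Sum>q\<in>UNIV. \<Sum>j\<in>UNIV. \<Sum>k\<in>UNIV. \<Sum>p\<in>UNIV.
       K $ p $ q * (W j / of_real t) * L $ j $ k * cnj (X q $ p $ k))"
      by (rule sum.cong[OF refl], rule sum_rotate3)
    also have "\<dots> = (\<Sum>j\<in>UNIV. \<Sum>k\<in>UNIV. \<Sum>q\<in>UNIV. \<Sum>p\<in>UNIV.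
       K $ p $ q * (W j / of_real t) * L $ j $ k * cnj (X q $ p $ k))"
      by (rule sum_rotate3)
    finally show ?thesis by (simp add: sum_distrib_left cK ac_simps)
  qed
  have 1: "pairing K L (\<lambda>p. L ** E p) D = form_pairing L W W / of_real t"
    unfolding ED W_def[THEN meta_eq_to_obj_eq, THEN fun_cong, symmetric]
    by (simp add: form_pairing_def sum_divide_distrib)
  \<comment> \<open>\<open>E\<close> has the same contraction as \<open>D\<close>, since contracting
    \<open>G\<close> with \<open>K\<close> gives the trace that was divided out.\<close>
  have WE: "(\<Sum>q\<in>UNIV. \<Sum>p\<in>UNIV. K $ q $ p * E q $ p $ k) = W k" for k
  proof -
    have "(\<Sum>q\<in>UNIV. \<Sum>p\<in>UNIV. K $ q $ p * E q $ p $ k) = trace (K ** G) * (W k / of_real t)"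
      by (simp add: E_def trace_def matrix_matrix_mult_def sum_distrib_right sum_divide_distrib mult.assoc)
    then show ?thesis using t by simp
  qed
  have 2: "pairing K L (\<lambda>p. L ** E p) E = form_pairing L W W / of_real t"
    unfolding ED WE by (simp add: form_pairing_def sum_divide_distrib)
  have 3: "pairing K L (\<lambda>p. L ** D p) E = cnj (form_pairing L W W / of_real t)"
    unfolding 1[symmetric] pairing_cnj[OF adj(1,2)]
    by (simp add: pairing_mult_left adj)
  obtain P :: "complex^'n^'n" where P: "K = P ** adjoint_mat P"
    unfolding K_def by (rule hermitian_posdef_inv_factorization[OF C])
  obtain Q :: "complex^'n^'n" where Q: "L = Q ** adjoint_mat Q"
    unfolding L_def by (rule hermitian_posdef_inv_factorization[OF G])
  \<comment> \<open>Both cross terms and the square of \<open>E\<close> have the same real part, so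
    the expansion leaves one negative copy of it.\<close>
  from pairing_nonneg[OF P Q, of "\<lambda>p. D p - E p"]
  have "0 \<le> Re (pairing K L (\<lambda>p. L ** D p) D - form_pairing L W W / of_real t)"
    by (simp add: matrix_diff_ldistrib pairing_linear 1 2 3)
  then show ?thesis using t by (simp add: field_simps)
qed

section \<open>The Chern connection applied to the relative endomorphism\<close>

text \<open>The inequality concerns first derivatives at a single point, so it is proved for two
  matrix functions on an open set of coordinates.\<close>

locale two_metrics =
  fixes S :: "(complex^'n::finite) set" and chi g :: "complex^'n \<Rightarrow> complex^'n^'n"
    and z :: "complex^'n"
  assumes S: "open S" "z \<in> S"
    and chi_diff: "\<And>p q. (\<lambda>w. chi w $ p $ q) differentiable (at z)"
    and g_diff: "\<And>p q. (\<lambda>w. g w $ p $ q) differentiable (at z)"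
    and chi_pos: "\<And>w. w \<in> S \<Longrightarrow> hermitian_posdef (chi w)"
    and g_pos: "\<And>w. w \<in> S \<Longrightarrow> hermitian_posdef (g w)"
begin

definition h where "h w = matrix_inv (chi w) ** g w"

lemma inv: "w \<in> S \<Longrightarrow> chi w ** matrix_inv (chi w) = mat 1" "w \<in> S \<Longrightarrow> matrix_inv (chi w) ** chi w = mat 1"
  "w \<in> S \<Longrightarrow> g w ** matrix_inv (g w) = mat 1" "w \<in> S \<Longrightarrow> matrix_inv (g w) ** g w = mat 1"
  using chi_pos g_pos by (simp_all add: matrix_inv_mult hermitian_posdef_invertible)

lemma h_diff: "(\<lambda>w. h w $ p $ q) differentiable (at z)"
proof -
  have "(\<lambda>w. matrix_inv (chi w) $ k $ l) differentiable (at z)" for k l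
    using chi_diff S chi_pos by (intro differentiable_matrix_inv) (auto intro: hermitian_posdef_invertible)
  then show ?thesis
    unfolding h_def matrix_matrix_mult_def by (simp add: g_diff)
qed

lemma chi_mult_h: "w \<in> S \<Longrightarrow> chi w ** h w = g w"
  by (simp add: h_def matrix_mul_assoc inv)

lemma chi_h_diff: "(\<lambda>w. (chi w ** h w) $ p $ q) differentiable (at z)"
  unfolding matrix_matrix_mult_def by (simp add: chi_diff h_diff)

lemma chi_christoffel: "chi z ** christoffel_mat chi j z = wirtinger_mat j chi z"
  using S by (simp add: christoffel_mat_eq matrix_mul_assoc inv)

text \<open>The lowered endomorphism \<open>\<nabla>\<^sub>j h\<close>, i.e. the matrix of \<open>\<nabla>\<^sub>j g\<close>, since \<open>\<nabla>\<chi> = 0\<close>.\<close>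

definition nabla_g where "nabla_g j = wirtinger_mat j g z - g z ** christoffel_mat chi j z"

text \<open>In the product rule for \<open>chi ** h = g\<close>, the derivative of
  \<open>chi\<close> equals \<open>chi\<close> times the connection matrix; the remaining terms are
  \<open>chi\<close> times the commutator form of the covariant derivative.\<close>

lemma nabla_end_h: "nabla_end chi j h z = matrix_inv (chi z) ** nabla_g j"
proof -
  have "wirtinger_mat j g z = wirtinger_mat j (\<lambda>w. chi w ** h w) z"
    unfolding wirtinger_mat_def using wirtinger_cong(1)[OF chi_h_diff S] chi_mult_h
    by (simp add: vec_eq_iff)
  then have "wirtinger_mat j g z = wirtinger_mat j chi z ** h z + chi z ** wirtinger_mat j h z"
    by (simp add: wirtinger_mat_mult chi_diff h_diff)
  then have "nabla_g j = chi z ** nabla_end chi j h z"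
    by (simp add: nabla_g_def nabla_end_eq matrix_add_ldistrib matrix_diff_ldistrib matrix_mul_assoc
        chi_christoffel chi_mult_h S)
  then show ?thesis by (simp add: matrix_mul_assoc inv S)
qed

text \<open>The barred derivative has no connection term, but differentiating
  \<open>chi ** h\<close> produces the barred derivative of \<open>chi\<close>, which matches the
  connection term in the adjoint of \<open>nabla_g\<close>.\<close>

lemma nabla_bar_end_h: "nabla_bar_end k h z = matrix_inv (chi z) ** adjoint_mat (nabla_g k)"
proof -
  have adj: "adjoint_mat (chi w) = chi w" "adjoint_mat (g w) = g w" if "w \<in> S" for w
    using that chi_pos g_pos by (simp_all add: hermitian_posdef_adjoint)
  have "adjoint_mat (wirtinger_mat k g z)
      = adjoint_mat (wirtinger_mat k chi z) ** h z + chi z ** nabla_bar_end k h z"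
  proof -
    have "adjoint_mat (wirtinger_mat k g z) $ p $ q = wirtinger_bar k (\<lambda>w. (chi w ** h w) $ p $ q) z" for p q
      using wirtinger_cong(2)[OF chi_h_diff S, where g = "\<lambda>w. g w $ p $ q"] chi_mult_h
      by (simp add: wirtinger_bar_hermitian[OF g_diff S adj(2)])
    then show ?thesis
      unfolding wirtinger_bar_mat_mult[OF chi_diff h_diff]
      by (simp add: wirtinger_bar_hermitian[OF chi_diff S adj(1)] vec_eq_iff
          matrix_matrix_mult_def nabla_bar_end_def)
  qed
  moreover have "adjoint_mat (wirtinger_mat k chi z) ** h z = adjoint_mat (christoffel_mat chi k z) ** g z"
    unfolding chi_christoffel[symmetric]
    by (simp add: adjoint_mat_mult adj S chi_mult_h flip: matrix_mul_assoc)
  moreover have "adjoint_mat (nabla_g k) = adjoint_mat (wirtinger_mat k g z) - adjoint_mat (christoffel_mat chi k z) ** g z"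
    using adjoint_mat_mult[of "g z" "christoffel_mat chi k z"] adj(2)[OF S(2)]
    by (simp add: nabla_g_def vec_eq_iff)
  ultimately have "adjoint_mat (nabla_g k) = chi z ** nabla_bar_end k h z" by simp
  then show ?thesis by (simp add: matrix_mul_assoc inv S)
qed

text \<open>The commutator with the connection matrix drops out of the trace.\<close>

lemma wirtinger_trace_h: "wirtinger j (\<lambda>w. trace (h w)) z = trace (matrix_inv (chi z) ** nabla_g j)"
proof -
  have "wirtinger j (\<lambda>w. trace (h w)) z = trace (wirtinger_mat j h z)"
    by (simp add: trace_def wirtinger_sum h_diff wirtinger_mat_def)
  also have "\<dots> = trace (nabla_end chi j h z)"
    unfolding nabla_end_eq by (simp add: trace_add trace_sub) (rule trace_mul_sym)
  finally show ?thesis by (simp add: nabla_end_h)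
qed

lemma wirtinger_bar_trace_h:
  "wirtinger_bar j (\<lambda>w. trace (h w)) z = cnj (wirtinger j (\<lambda>w. trace (h w)) z)"
proof -
  have "wirtinger_bar j (\<lambda>w. trace (h w)) z = trace (nabla_bar_end j h z)"
    by (simp add: trace_def wirtinger_sum h_diff nabla_bar_end_def)
  also have "\<dots> = cnj (trace (matrix_inv (chi z) ** nabla_g j))"
    using hermitian_posdef_inv_adjoint[OF chi_pos[OF S(2)]]
    by (simp add: nabla_bar_end_h adjoint_mat_mult trace_mul_sym[of "nabla_g j"] flip: trace_adjoint_mat)
       (rule trace_mul_sym)
  finally show ?thesis by (simp add: wirtinger_trace_h)
qed

section \<open>Torsion and the exchange of a derivative index with a tensor index\<close>

definition T_mat where "T_mat p = (\<chi> r j. torsion chi r p j z)"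

definition alpha_mat where "alpha_mat p = (\<chi> r j. alpha chi g r p j z)"

text \<open>Lowering the upper index cancels the inverse metric in the Christoffel symbols.\<close>

lemma chi_T_mat: "(chi z ** T_mat p) $ q $ j
    = wirtinger p (\<lambda>w. chi w $ q $ j) z - wirtinger j (\<lambda>w. chi w $ q $ p) z"
proof -
  have "(chi z ** T_mat p) $ q $ j
    = (chi z ** christoffel_mat chi p z) $ q $ j - (chi z ** christoffel_mat chi j z) $ q $ p"
    by (simp add: matrix_matrix_mult_def T_mat_def torsion_def christoffel_mat_def
        right_diff_distrib sum_subtractf)
  then show ?thesis by (simp add: chi_christoffel wirtinger_mat_def)
qed

text \<open>The antisymmetrized derivative of \<open>g\<close> is \<open>alpha\<close> plus that of
  \<open>chi\<close>, and the latter is minus the lowered torsion. The connection terms differ by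
  \<open>g z ** T_mat p\<close>.\<close>

lemma nabla_g_swap: "nabla_g j $ q $ p = (nabla_g p + g z ** T_mat p + alpha_mat p - chi z ** T_mat p) $ q $ j"
proof -
  have gT: "(g z ** T_mat p) $ q $ j
      = (g z ** christoffel_mat chi p z) $ q $ j - (g z ** christoffel_mat chi j z) $ q $ p"
    by (simp add: matrix_matrix_mult_def T_mat_def torsion_def christoffel_mat_def
        right_diff_distrib sum_subtractf)
  show ?thesis
    by (simp add: chi_T_mat gT)
       (simp add: nabla_g_def alpha_mat_def alpha_def wirtinger_diff g_diff chi_diff wirtinger_mat_def)
qed

section \<open>The terms of the inequality as pairings\<close>

abbreviation "K \<equiv> matrix_inv (chi z)"
abbreviation "L \<equiv> matrix_inv (g z)"
abbreviation "d j \<equiv> wirtinger j (\<lambda>w. trace (h w)) z"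
abbreviation "\<tau> j \<equiv> torsion_form chi j z"
abbreviation "\<alpha> j \<equiv> alpha_form chi g j z"

text \<open>
  With this torsion correction the terms of the inequality that are linear in both \<open>\<nabla>h\<close> and \<open>T\<close>
  complete \<open>\<bar>\<nabla>h\<bar>\<^sup>2\<close> to \<open>\<bar>D\<bar>\<^sup>2\<close>.
\<close>

definition D where "D p = nabla_g p + g z ** T_mat p"

lemma adj: "adjoint_mat K = K" "adjoint_mat L = L" "adjoint_mat (chi z) = chi z" "adjoint_mat (g z) = g z"
  using chi_pos[OF S(2)] g_pos[OF S(2)]
  by (simp_all add: hermitian_posdef_inv_adjoint hermitian_posdef_adjoint)

lemma matrix_inv_h: "matrix_inv (h z) = L ** chi z"
proof -
  have "h z ** (L ** chi z) = K ** (g z ** L) ** chi z"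
    by (simp add: h_def matrix_mul_assoc)
  then have 1: "h z ** (L ** chi z) = mat 1" by (simp add: inv S)
  then have "invertible (h z)" by (auto simp: invertible_right_inverse)
  then have "matrix_inv (h z) ** (h z ** (L ** chi z)) = L ** chi z"
    by (simp add: matrix_mul_assoc matrix_inv_mult)
  then show ?thesis by (simp add: 1)
qed

text \<open>The factor \<open>chi z\<close> in the inverse of \<open>h\<close> cancels the
  \<open>K\<close> in both covariant derivatives.\<close>

lemma norm_nabla_h: "(\<Sum>p\<in>UNIV. \<Sum>q\<in>UNIV. K $ p $ q
      * trace (matrix_inv (h z) ** nabla_end chi p h z ** matrix_inv (h z) ** nabla_bar_end q h z))
    = pairing K L (\<lambda>p. L ** nabla_g p) nabla_g"
proof -
  have "matrix_inv (h z) ** nabla_end chi p h z = L ** nabla_g p"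
    "matrix_inv (h z) ** nabla_bar_end p h z = L ** adjoint_mat (nabla_g p)" for p
    unfolding nabla_end_h nabla_bar_end_h matrix_inv_h
    by (metis inv(1) S(2) matrix_mul_assoc matrix_mul_rid)+
  then show ?thesis by (simp add: pairing_def flip: matrix_mul_assoc)
qed

lemma nabla_h_torsion: "(\<Sum>p\<in>UNIV. \<Sum>q\<in>UNIV. \<Sum>s\<in>UNIV. \<Sum>r\<in>UNIV. \<Sum>j\<in>UNIV. \<Sum>k\<in>UNIV.
      K $ p $ q * chi z $ s $ r * L $ j $ k * nabla_end chi p h z $ r $ j * cnj (torsion chi s q k z))
    = pairing K L nabla_g T_mat"
proof -
  have "nabla_g = (\<lambda>p. chi z ** nabla_end chi p h z)"
    by (simp add: nabla_end_h matrix_mul_assoc inv S)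
  then have "pairing K L nabla_g T_mat = pairing K L (\<lambda>p. chi z ** nabla_end chi p h z) T_mat" by simp
  then show ?thesis unfolding pairing_expand_mult by (simp add: T_mat_def)
qed

text \<open>Here the derivative index is contracted with \<open>L\<close>, whereas
  \<open>pairing\<close> contracts it with \<open>K\<close>. The exchange by
  \<open>nabla_g_swap\<close> repairs this and brings in \<open>alpha_mat\<close> and the lowered
  torsion.\<close>

lemma nabla_bar_h_torsion: "(\<Sum>j\<in>UNIV. \<Sum>k\<in>UNIV. \<Sum>p\<in>UNIV. \<Sum>r\<in>UNIV.
      L $ j $ k * nabla_bar_end k h z $ p $ r * torsion chi r p j z)
    = pairing K L T_mat (\<lambda>p. D p + alpha_mat p - chi z ** T_mat p)" (is "?l = pairing K L T_mat ?Y")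
proof -
  have "nabla_g k $ r $ q = ?Y q $ r $ k" for k q r
    unfolding nabla_g_swap[of k] by (simp add: D_def)
  then have "nabla_bar_end k h z $ p $ r = (\<Sum>q\<in>UNIV. K $ p $ q * cnj (?Y q $ r $ k))" for k p r
    by (simp add: nabla_bar_end_h matrix_matrix_mult_def[of K])
  then have "?l = (\<Sum>j\<in>UNIV. \<Sum>k\<in>UNIV. \<Sum>p\<in>UNIV. \<Sum>r\<in>UNIV. \<Sum>q\<in>UNIV.
      K $ p $ q * T_mat p $ r $ j * L $ j $ k * cnj (?Y q $ r $ k))"
    by (simp add: sum_distrib_left sum_distrib_right T_mat_def ac_simps)
  also have "\<dots> = (\<Sum>p\<in>UNIV. \<Sum>j\<in>UNIV. \<Sum>k\<in>UNIV. \<Sum>q\<in>UNIV. \<Sum>r\<in>UNIV.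
      K $ p $ q * T_mat p $ r $ j * L $ j $ k * cnj (?Y q $ r $ k))"
    by (rule trans[OF sum_rotate3[symmetric]], rule sum.cong[OF refl], rule sum.cong[OF refl],
        rule sum.cong[OF refl], rule sum.swap)
  also have "\<dots> = (\<Sum>p\<in>UNIV. \<Sum>q\<in>UNIV. \<Sum>j\<in>UNIV. \<Sum>k\<in>UNIV. \<Sum>r\<in>UNIV.
      K $ p $ q * T_mat p $ r $ j * L $ j $ k * cnj (?Y q $ r $ k))"
    by (rule sum.cong[OF refl], rule sum_rotate3[symmetric])
  also have "\<dots> = pairing K L T_mat ?Y"
    unfolding pairing_expand
    by (rule sum.cong[OF refl], rule sum.cong[OF refl], rule sum_rotate3[symmetric])
  finally show ?thesis .
qed

lemma norm_torsion: "(\<Sum>p\<in>UNIV. \<Sum>q\<in>UNIV. \<Sum>j\<in>UNIV. \<Sum>k\<in>UNIV. \<Sum>s\<in>UNIV. \<Sum>r\<in>UNIV.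
      K $ p $ q * L $ j $ k * chi z $ s $ r * torsion chi r p j z * cnj (torsion chi s q k z))
    = pairing K L (\<lambda>p. chi z ** T_mat p) T_mat"
proof -
  have *: "(\<Sum>j\<in>UNIV. \<Sum>k\<in>UNIV. \<Sum>s\<in>UNIV. \<Sum>r\<in>UNIV. f s r j k)
      = (\<Sum>s\<in>UNIV. \<Sum>r\<in>UNIV. \<Sum>j\<in>UNIV. \<Sum>k\<in>UNIV. f s r j k)"
    for f :: "'n \<Rightarrow> 'n \<Rightarrow> 'n \<Rightarrow> 'n \<Rightarrow> complex"
    by (rule trans[OF sum_rotate3[symmetric]], rule sum.cong[OF refl], rule sum_rotate3[symmetric])
  show ?thesis
    unfolding pairing_expand_mult
    by (rule sum.cong[OF refl], rule sum.cong[OF refl], rule trans[OF *]) (simp add: T_mat_def ac_simps)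
qed

lemma torsion_alpha: "(\<Sum>p\<in>UNIV. \<Sum>q\<in>UNIV. \<Sum>j\<in>UNIV. \<Sum>k\<in>UNIV. \<Sum>r\<in>UNIV.
      K $ p $ q * L $ j $ k * torsion chi r p j z * cnj (alpha chi g r q k z))
    = pairing K L T_mat alpha_mat"
  unfolding pairing_expand
  by (rule sum.cong[OF refl], rule sum.cong[OF refl], rule trans[OF sum_rotate3[symmetric]])
     (simp add: T_mat_def alpha_mat_def ac_simps)

text \<open>Contract \<open>nabla_g_swap\<close> with \<open>K\<close>: the left side becomes the
  derivative of the trace, and the lowered torsion becomes the torsion form.\<close>

lemma contraction_D: "(\<Sum>p\<in>UNIV. \<Sum>s\<in>UNIV. K $ p $ s * D p $ s $ j) = d j - \<alpha> j + \<tau> j"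
proof -
  have "d j = (\<Sum>p\<in>UNIV. \<Sum>s\<in>UNIV. K $ p $ s * nabla_g j $ s $ p)"
    unfolding wirtinger_trace_h by (simp add: trace_def matrix_matrix_mult_def[of K])
  also have "\<dots> = (\<Sum>p\<in>UNIV. \<Sum>s\<in>UNIV. K $ p $ s * D p $ s $ j)
      + (\<Sum>p\<in>UNIV. \<Sum>s\<in>UNIV. K $ p $ s * alpha_mat p $ s $ j)
      - (\<Sum>p\<in>UNIV. \<Sum>s\<in>UNIV. K $ p $ s * (chi z ** T_mat p) $ s $ j)"
    unfolding nabla_g_swap[of j] by (simp add: D_def algebra_simps sum.distrib sum_subtractf)
  also have "(\<Sum>p\<in>UNIV. \<Sum>s\<in>UNIV. K $ p $ s * (chi z ** T_mat p) $ s $ j) = \<tau> j"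
  proof -
    have "(\<Sum>s\<in>UNIV. K $ p $ s * (chi z ** T_mat p) $ s $ j) = (K ** (chi z ** T_mat p)) $ p $ j" for p
      by (simp add: matrix_matrix_mult_def[of K])
    then show ?thesis by (simp add: matrix_mul_assoc inv S T_mat_def torsion_form_def)
  qed
  finally show ?thesis by (simp add: alpha_form_def alpha_mat_def)
qed

text \<open>Expand \<open>D\<close> first in the left argument, then in the right one. Wherever
  \<open>g z ** T_mat\<close> is split off, \<open>g z\<close> cancels against
  \<open>L\<close>.\<close>

lemma norm_D: "pairing K L (\<lambda>p. L ** D p) D
    = pairing K L (\<lambda>p. L ** nabla_g p) nabla_g + pairing K L nabla_g T_mat + pairing K L T_mat D"
proof -
  have "pairing K L (\<lambda>p. L ** D p) D = pairing K L (\<lambda>p. L ** nabla_g p) D + pairing K L T_mat D"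
    unfolding pairing_linear(1)[symmetric]
    by (simp add: D_def matrix_add_ldistrib matrix_mul_assoc inv S)
  moreover have "pairing K L (\<lambda>p. L ** nabla_g p) D = pairing K L (\<lambda>p. L ** nabla_g p) nabla_g + pairing K L nabla_g T_mat"
  proof -
    have "pairing K L (\<lambda>p. L ** nabla_g p) (\<lambda>p. g z ** T_mat p) = pairing K L nabla_g T_mat"
      by (simp add: pairing_mult_left adj matrix_mul_assoc inv S)
    then show ?thesis by (simp add: D_def[abs_def] pairing_linear)
  qed
  ultimately show ?thesis by simp
qed

lemma trace_h: "trace (h z) = of_real (Re (trace (h z)))" "0 < Re (trace (h z))"
  using trace_inv_mult_pos[OF chi_pos[OF S(2)] g_pos[OF S(2)]]
  by (simp_all add: h_def complex_eq_iff)

text \<open>The order on complex numbers compares real parts and demands equal imaginary parts, so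
  the terms stated without a real part must be shown real.\<close>

lemma real_pairings:
  "Im (form_pairing L u u) = 0" "Im (pairing K L (\<lambda>p. L ** X p) X) = 0"
  "Im (pairing K L (\<lambda>p. chi z ** X p) X) = 0"
proof -
  have *: "Im c = 0" if "cnj c = c" for c using that by (simp add: complex_eq_iff)
  show "Im (form_pairing L u u) = 0" "Im (pairing K L (\<lambda>p. L ** X p) X) = 0"
    "Im (pairing K L (\<lambda>p. chi z ** X p) X) = 0"
    by (rule *, simp add: form_pairing_cnj pairing_cnj adj, simp add: pairing_mult_left adj)+
qed

text \<open>By \<open>norm_D\<close> the terms in \<open>nabla_g\<close> and \<open>D\<close> on the
  left add up to minus the squared norm of \<open>D\<close>, which
  \<open>contraction_Cauchy_Schwarz\<close> bounds from above.\<close>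

lemma gradient_inequality:
  fixes t :: real
  defines "t \<equiv> Re (trace (h z))"
  shows "Re (form_pairing L d d) / t - Re (pairing K L (\<lambda>p. L ** nabla_g p) nabla_g) - Re (pairing K L nabla_g T_mat)
      - Re (pairing K L T_mat (\<lambda>p. D p + alpha_mat p - chi z ** T_mat p))
    \<le> - 2 * Re (form_pairing L d \<tau>) / t - Re (form_pairing L \<tau> \<tau>) / t
      + Re (pairing K L (\<lambda>p. chi z ** T_mat p) T_mat) + 2 * Re (form_pairing L d \<alpha>) / t
      + 2 * Re (form_pairing L \<tau> \<alpha>) / t - Re (pairing K L T_mat alpha_mat)
      - Re (form_pairing L \<alpha> \<alpha>) / t"
proof -
  let ?W = "\<lambda>j. d j - \<alpha> j + \<tau> j"
  have sym: "Re (form_pairing L u v) = Re (form_pairing L v u)" for u v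
    using form_pairing_cnj[OF adj(2), of u v] by (metis complex_cnj(1) cnj.simps(1))
  have "Re (form_pairing L ?W ?W) \<le> t * Re (pairing K L (\<lambda>p. L ** D p) D)"
    using contraction_Cauchy_Schwarz[OF chi_pos[OF S(2)] g_pos[OF S(2)], of D]
    by (simp add: contraction_D t_def h_def)
  then have "Re (form_pairing L ?W ?W) / t \<le> Re (pairing K L (\<lambda>p. L ** D p) D)"
    using trace_h(2) by (simp add: t_def field_simps)
  \<comment> \<open>The expansion yields every form term of the claim; the square of
    \<open>d\<close> cancels against the first term on the left.\<close>
  moreover have "Re (form_pairing L ?W ?W) = Re (form_pairing L d d) + Re (form_pairing L \<alpha> \<alpha>)
      + Re (form_pairing L \<tau> \<tau>) - 2 * Re (form_pairing L d \<alpha>) + 2 * Re (form_pairing L d \<tau>)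
      - 2 * Re (form_pairing L \<tau> \<alpha>)"
    by (simp add: form_pairing_linear sym[of \<alpha> d] sym[of \<tau> d] sym[of \<alpha> \<tau>])
  moreover have "pairing K L T_mat (\<lambda>p. chi z ** T_mat p) = pairing K L (\<lambda>p. chi z ** T_mat p) T_mat"
    by (simp add: pairing_mult_left adj)
  ultimately show ?thesis
    by (simp add: norm_D pairing_linear add_divide_distrib diff_divide_distrib)
qed

end

section \<open>Transfer to a chart of the manifold\<close>

theorem theorem3:
  fixes X :: "'a topology" and A :: "('a, 'n::finite) chart set"
    and Chi Omega :: "('a, 'n) chart \<Rightarrow> complex^'n \<Rightarrow> complex^'n^'n"
    and U :: "'a set" and \<phi> :: "'a \<Rightarrow> complex^'n" and x :: 'a and z :: "complex^'n"
    and chi g h :: "complex^'n \<Rightarrow> complex^'n^'n"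
    and chi_inv g_inv h_inv :: "complex^'n^'n"
    and Tr_h :: complex and dTr_h dbarTr_h T' \<alpha>' :: "'n \<Rightarrow> complex"
    and T \<alpha> :: "'n \<Rightarrow> 'n \<Rightarrow> 'n \<Rightarrow> complex"
  assumes "compact_complex_manifold X A"
    and "hermitian_metric A Chi" and "hermitian_metric A Omega"
    and "(U, \<phi>) \<in> A" and "x \<in> U" and "z = \<phi> x"
    and "chi = Chi (U, \<phi>)" and "g = Omega (U, \<phi>)"
    and "h = (\<lambda>w. matrix_inv (chi w) ** g w)"
    and "chi_inv = matrix_inv (chi z)" and "g_inv = matrix_inv (g z)" and "h_inv = matrix_inv (h z)"
    and "Tr_h = trace (h z)"
    and "\<And>j. dTr_h j = wirtinger j (\<lambda>w. trace (h w)) z"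
    and "\<And>k. dbarTr_h k = wirtinger_bar k (\<lambda>w. trace (h w)) z"
    and "\<And>p j q. T p j q = torsion chi p j q z"
    and "\<And>j. T' j = torsion_form chi j z"
    and "\<And>q p j. \<alpha> q p j = alpha chi g q p j z"
    and "\<And>j. \<alpha>' j = alpha_form chi g j z"
  shows
    "(\<Sum>j\<in>UNIV. \<Sum>k\<in>UNIV. g_inv $ j $ k * dTr_h j * dbarTr_h k) / Tr_h
     - (\<Sum>p\<in>UNIV. \<Sum>q\<in>UNIV. chi_inv $ p $ q
          * trace (h_inv ** nabla_end chi p h z ** h_inv ** nabla_bar_end q h z))
     - of_real (Re (\<Sum>p\<in>UNIV. \<Sum>q\<in>UNIV. \<Sum>s\<in>UNIV. \<Sum>r\<in>UNIV. \<Sum>j\<in>UNIV. \<Sum>k\<in>UNIV.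
          chi_inv $ p $ q * chi z $ s $ r * g_inv $ j $ k * nabla_end chi p h z $ r $ j * cnj (T s q k)))
     - of_real (Re (\<Sum>j\<in>UNIV. \<Sum>k\<in>UNIV. \<Sum>p\<in>UNIV. \<Sum>r\<in>UNIV.
          g_inv $ j $ k * nabla_bar_end k h z $ p $ r * T r p j))
     \<le> - of_real (2 * Re (\<Sum>j\<in>UNIV. \<Sum>k\<in>UNIV. g_inv $ j $ k * (dTr_h j / Tr_h) * cnj (T' k)))
     - 1 / Tr_h * (\<Sum>j\<in>UNIV. \<Sum>k\<in>UNIV. g_inv $ j $ k * T' j * cnj (T' k))
     + (\<Sum>p\<in>UNIV. \<Sum>q\<in>UNIV. \<Sum>j\<in>UNIV. \<Sum>k\<in>UNIV. \<Sum>s\<in>UNIV. \<Sum>r\<in>UNIV.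
          chi_inv $ p $ q * g_inv $ j $ k * chi z $ s $ r * T r p j * cnj (T s q k))
     + of_real (2 * Re (\<Sum>j\<in>UNIV. \<Sum>k\<in>UNIV. g_inv $ j $ k * (dTr_h j / Tr_h) * cnj (\<alpha>' k)))
     + 1 / Tr_h * of_real (2 * Re (\<Sum>j\<in>UNIV. \<Sum>k\<in>UNIV. g_inv $ j $ k * T' j * cnj (\<alpha>' k)))
     - of_real (Re (\<Sum>p\<in>UNIV. \<Sum>q\<in>UNIV. \<Sum>j\<in>UNIV. \<Sum>k\<in>UNIV. \<Sum>r\<in>UNIV.
          chi_inv $ p $ q * g_inv $ j $ k * T r p j * cnj (\<alpha> r q k)))
     - 1 / Tr_h * (\<Sum>j\<in>UNIV. \<Sum>k\<in>UNIV. g_inv $ j $ k * \<alpha>' j * cnj (\<alpha>' k))"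
proof -
  have atlas: "\<forall>c\<in>A. chart_on X c"
    using assms(1) unfolding compact_complex_manifold_def complex_manifold_def by blast
  have S: "open (\<phi> ` U)" "z \<in> \<phi> ` U"
    using atlas assms(4-6) by (auto simp: Ball_def)
  have metric: "smooth_fun_on (\<lambda>w. M (U, \<phi>) w $ k $ j) (\<phi> ` U)"
    "w \<in> \<phi> ` U \<Longrightarrow> hermitian_posdef (M (U, \<phi>) w)" if "hermitian_metric A M" for M k j w
    using that \<open>(U, \<phi>) \<in> A\<close> unfolding hermitian_metric_def by blast+
  \<comment> \<open>The open set is the image of the chart, where both coefficient matrices are
    smooth and positive definite.\<close>
  interpret m: two_metrics "\<phi> ` U" chi g z
    using S metric[OF assms(2)] metric[OF assms(3)] smooth_fun_on_differentiable
    unfolding two_metrics_def assms(7,8) by blast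
  have h: "h = m.h"
    by (simp add: assms(9) m.h_def fun_eq_iff)
  define t where "t = Re (trace (m.h z))"
  have t: "trace (m.h z) = of_real t"
    using m.trace_h(1) by (simp add: t_def)
  note eqs = assms(10-19) h
  have 1: "(\<Sum>j\<in>UNIV. \<Sum>k\<in>UNIV. g_inv $ j $ k * dTr_h j * dbarTr_h k)
      = form_pairing m.L m.d m.d"
    by (simp add: eqs form_pairing_def m.wirtinger_bar_trace_h)
  have 2: "(\<Sum>j\<in>UNIV. \<Sum>k\<in>UNIV. g_inv $ j $ k * (dTr_h j / Tr_h) * cnj (v k))
      = form_pairing m.L m.d v / of_real t" for v
    unfolding form_pairing_linear(3)[symmetric] by (simp add: eqs form_pairing_def t)
  have 3: "(\<Sum>j\<in>UNIV. \<Sum>k\<in>UNIV. g_inv $ j $ k * u j * cnj (v k)) = form_pairing m.L u v" for u v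
    by (simp add: eqs form_pairing_def)
  have T: "T' = m.\<tau>" "\<alpha>' = m.\<alpha>" by (simp_all add: eqs fun_eq_iff)
  \<comment> \<open>Once every sum is a pairing, \<open>real_pairings\<close> settles the imaginary
    parts and \<open>gradient_inequality\<close> the real parts.\<close>
  show ?thesis
    unfolding 1 2 3 T
    unfolding eqs m.norm_nabla_h m.nabla_h_torsion m.nabla_bar_h_torsion m.norm_torsion m.torsion_alpha t
    using m.gradient_inequality[folded t_def]
    by (simp add: less_eq_complex_def m.real_pairings)
qed

end
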